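(* Let $R$ be a commutative ring and let $A=\sigma(R)\langle x_1,\dots,x_n\rangle$ be a skew PBW extension of $R$ with associated endomorphisms $\sigma_i$ and $\sigma_i$-derivations $\delta_i$, $1\le i\le n$. Suppose that $\delta_i=0$ for all $1\le i\le n$. Then the centralizer $C(R)$ of $R$ in $A$ is $$C(R)=\left\{\sum_{\alpha}f_{\alpha}x^{\alpha}\in A\ :\ (\sigma^{\alpha}(r)-r)f_{\alpha}=0 \text{ for all } r\in R \text{ and all } \alpha\in\mathbb{N}^n\right\}.$$
   Context: Here $\mathbb{N}=\{0,1,2,\dots\}$. Let $R\subseteq A$ be rings. $A$ is a skew PBW extension (or $\sigma$-PBW extension) of $R$, written $A=\sigma(R)\langle x_1,\dots,x_n\rangle$, if: (a) $R\subseteq A$; (b) there are elements $x_1,\dots,x_n\in A$ such that $A$ is a free left $R$-module with basis $\mathrm{Mon}(A)=\{x^{\alpha}=x_1^{\alpha_1}\cdots x_n^{\alpha_n} : \alpha=(\alpha_1,\dots,\alpha_n)\in\mathbb{N}^n\}$; (c) for every $1\le i\le n$ and $r\in R\setminus\{0\}$ there is $c_{i,r}\in R\setminus\{0\}$ with $x_ir-c_{i,r}x_i\in R$; (d) for all $1\le i,j\le n$ there is $c_{i,j}\in R\setminus\{0\}$ with $x_jx_i-c_{i,j}x_ix_j\in R+Rx_1+\cdots+Rx_n$. It is known that then for each $1\le i\le n$ there are an injective ring endomorphism $\sigma_i:R\to R$ and a $\sigma_i$-derivation $\delta_i:R\to R$ such that $x_ir=\sigma_i(r)x_i+\delta_i(r)$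 for all $r\in R$; these are the associated endomorphisms and derivations. For $\alpha\in\mathbb{N}^n$ put $\sigma^{\alpha}=\sigma_1^{\alpha_1}\cdots\sigma_n^{\alpha_n}$ (composition). Every element of $A$ is uniquely a finite sum $\sum_{\alpha}f_{\alpha}x^{\alpha}$ with $f_\alpha\in R$. The centralizer of $R$ in $A$ is $C(R)=\{f\in A: fr=rf\ \text{for all } r\in R\}$. *)

theory Defs
  imports "HOL-Algebra.Subrings"
begin

text \<open>
  An element of \<open>\<nat>\<^sup>n\<close> is a function \<open>\<alpha> :: nat \<Rightarrow> nat\<close> that vanishes outside \<open>{1..n}\<close>.
\<close>

definition multi_indices :: "nat \<Rightarrow> (nat \<Rightarrow> nat) set" where
  "multi_indices n = {\<alpha>. \<forall>i. i \<notin> {1..n} \<longrightarrow> \<alpha> i = 0}"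

text \<open>\<open>monomial A x n \<alpha>\<close> is the ordered product \<open>x\<^sub>1^\<alpha>\<^sub>1 \<cdots> x\<^sub>n^\<alpha>\<^sub>n\<close>; the \<open>x\<^sub>i\<close> need not commute.\<close>

primrec monomial ::
  "('a, 'm) ring_scheme \<Rightarrow> (nat \<Rightarrow> 'a) \<Rightarrow> nat \<Rightarrow> (nat \<Rightarrow> nat) \<Rightarrow> 'a" where
  "monomial A x 0 \<alpha> = \<one>\<^bsub>A\<^esub>"
| "monomial A x (Suc k) \<alpha> = monomial A x k \<alpha> \<otimes>\<^bsub>A\<^esub> (x (Suc k) [^]\<^bsub>A\<^esub> \<alpha> (Suc k))"

text \<open>\<open>sigma_pow \<sigma> n \<alpha> = \<sigma>\<^sub>1^\<alpha>\<^sub>1 \<circ> \<cdots> \<circ> \<sigma>\<^sub>n^\<alpha>\<^sub>n\<close>.\<close>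

primrec sigma_pow ::
  "(nat \<Rightarrow> 'a \<Rightarrow> 'a) \<Rightarrow> nat \<Rightarrow> (nat \<Rightarrow> nat) \<Rightarrow> 'a \<Rightarrow> 'a" where
  "sigma_pow \<sigma> 0 \<alpha> = id"
| "sigma_pow \<sigma> (Suc k) \<alpha> = sigma_pow \<sigma> k \<alpha> \<circ> (\<sigma> (Suc k) ^^ \<alpha> (Suc k))"

text \<open>
  Finitely supported families of coefficients in \<open>R\<close> indexed by \<open>I\<close>. They are set to zero
  outside \<open>I\<close>, so that two of them are equal exactly if they agree on \<open>I\<close>.
\<close>

definition finsupp_coeffs ::
  "('a, 'm) ring_scheme \<Rightarrow> 'a set \<Rightarrow> 'i set \<Rightarrow> ('i \<Rightarrow> 'a) set" where
  "finsupp_coeffs A R I =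
     {f. (\<forall>i\<in>I. f i \<in> R) \<and> (\<forall>i. i \<notin> I \<longrightarrow> f i = \<zero>\<^bsub>A\<^esub>) \<and> finite {i. f i \<noteq> \<zero>\<^bsub>A\<^esub>}}"

definition left_lincomb ::
  "('a, 'm) ring_scheme \<Rightarrow> ('i \<Rightarrow> 'a) \<Rightarrow> ('i \<Rightarrow> 'a) \<Rightarrow> 'a" where
  "left_lincomb A b f = (\<Oplus>\<^bsub>A\<^esub> i \<in> {i. f i \<noteq> \<zero>\<^bsub>A\<^esub>}. f i \<otimes>\<^bsub>A\<^esub> b i)"

text \<open>
  The family \<open>(b i)\<close>, \<open>i \<in> I\<close>, is a basis of \<open>A\<close> as a free left \<open>R\<close>-module. As \<open>b\<close> is a
  family and not a set, its members are distinct unless \<open>A\<close> is the zero ring.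
\<close>

definition free_left_basis ::
  "('a, 'm) ring_scheme \<Rightarrow> 'a set \<Rightarrow> 'i set \<Rightarrow> ('i \<Rightarrow> 'a) \<Rightarrow> bool" where
  "free_left_basis A R I b \<longleftrightarrow>
     (\<forall>i\<in>I. b i \<in> carrier A) \<and>
     (\<forall>a\<in>carrier A. \<exists>!f. f \<in> finsupp_coeffs A R I \<and> a = left_lincomb A b f)"

locale skew_PBW_extension = ring A + subring R A
  for A :: "('a, 'm) ring_scheme" (structure) and R :: "'a set"
    and n :: nat and x :: "nat \<Rightarrow> 'a" +
  assumes x_closed: "\<And>i. i \<in> {1..n} \<Longrightarrow> x i \<in> carrier A"
    and basis: "free_left_basis A R (multi_indices n) (monomial A x n)"
    and x_coeff: "\<And>i r. \<lbrakk>i \<in> {1..n}; r \<in> R - {\<zero>}\<rbrakk> \<Longrightarrow>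
          \<exists>c \<in> R - {\<zero>}. x i \<otimes> r \<ominus> c \<otimes> x i \<in> R"
    and x_x: "\<And>i j. \<lbrakk>i \<in> {1..n}; j \<in> {1..n}\<rbrakk> \<Longrightarrow>
          \<exists>c \<in> R - {\<zero>}. \<exists>s \<in> R. \<exists>t \<in> {1..n} \<rightarrow> R.
            x j \<otimes> x i \<ominus> c \<otimes> x i \<otimes> x j = s \<oplus> (\<Oplus>k\<in>{1..n}. t k \<otimes> x k)"

definition skew_derivation ::
  "('a, 'm) ring_scheme \<Rightarrow> ('a \<Rightarrow> 'a) \<Rightarrow> ('a \<Rightarrow> 'a) \<Rightarrow> bool" where
  "skew_derivation R \<sigma> \<delta> \<longleftrightarrow>
     \<delta> \<in> carrier R \<rightarrow> carrier R \<and>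
     (\<forall>r\<in>carrier R. \<forall>s\<in>carrier R.
        \<delta> (r \<oplus>\<^bsub>R\<^esub> s) = \<delta> r \<oplus>\<^bsub>R\<^esub> \<delta> s \<and>
        \<delta> (r \<otimes>\<^bsub>R\<^esub> s) = \<sigma> r \<otimes>\<^bsub>R\<^esub> \<delta> s \<oplus>\<^bsub>R\<^esub> \<delta> r \<otimes>\<^bsub>R\<^esub> s)"

text \<open>
  For a skew PBW extension such \<open>\<sigma>\<close> and \<open>\<delta>\<close> exist, and their values on \<open>R\<close> are determined
  by the last equation, because \<open>1\<close> and \<open>x\<^sub>i\<close> belong to the basis.
\<close>

definition associated_maps ::
  "('a, 'm) ring_scheme \<Rightarrow> 'a set \<Rightarrow> nat \<Rightarrow> (nat \<Rightarrow> 'a) \<Rightarrow>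
     (nat \<Rightarrow> 'a \<Rightarrow> 'a) \<Rightarrow> (nat \<Rightarrow> 'a \<Rightarrow> 'a) \<Rightarrow> bool" where
  "associated_maps A R n x \<sigma> \<delta> \<longleftrightarrow>
     (\<forall>i\<in>{1..n}.
        \<sigma> i \<in> ring_hom (A\<lparr>carrier := R\<rparr>) (A\<lparr>carrier := R\<rparr>) \<and>
        inj_on (\<sigma> i) R \<and>
        skew_derivation (A\<lparr>carrier := R\<rparr>) (\<sigma> i) (\<delta> i) \<and>
        (\<forall>r\<in>R. x i \<otimes>\<^bsub>A\<^esub> r = \<sigma> i r \<otimes>\<^bsub>A\<^esub> x i \<oplus>\<^bsub>A\<^esub> \<delta> i r))"

definition centralizer :: "('a, 'm) ring_scheme \<Rightarrow> 'a set \<Rightarrow> 'a set" where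
  "centralizer A R = {f \<in> carrier A. \<forall>r\<in>R. f \<otimes>\<^bsub>A\<^esub> r = r \<otimes>\<^bsub>A\<^esub> f}"

end

(*
  Since the derivations vanish, x^\<alpha> r = \<sigma>^\<alpha>(r) x^\<alpha>. For f = \<Sum> f_\<alpha> x^\<alpha> this makes f r and r f the
  combinations with coefficients f_\<alpha> \<sigma>^\<alpha>(r) and r f_\<alpha>, which agree exactly when these coefficients
  do, as the monomials are a left basis; commutativity of R turns this into (\<sigma>^\<alpha>(r) - r) f_\<alpha> = 0.
*)

theory Submission
  imports Defs
begin

context ring
begin

text \<open>The added terms have coefficient \<open>\<zero>\<close>. The larger range is needed
  because \<open>left_lincomb\<close> sums over the exact support, and multiplying the coefficients
  by ring elements may shrink that support.\<close>

lemma left_lincomb_superset: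
  assumes "finite S" "{i. f i \<noteq> \<zero>} \<subseteq> S"
    and "\<And>i. i \<in> S \<Longrightarrow> f i \<in> carrier R" "\<And>i. i \<in> S \<Longrightarrow> b i \<in> carrier R"
  shows "left_lincomb R b f = (\<Oplus>i\<in>S. f i \<otimes> b i)"
  unfolding left_lincomb_def
  using assms by (intro add.finprod_mono_neutral_cong_left) auto

lemma left_lincomb_closed:
  assumes "\<And>i. f i \<in> carrier R" "\<And>i. f i \<noteq> \<zero> \<Longrightarrow> b i \<in> carrier R"
  shows "left_lincomb R b f \<in> carrier R"
  unfolding left_lincomb_def using assms by (auto intro!: finsum_closed)

lemma mult_left_lincomb:
  assumes "finite {i. f i \<noteq> \<zero>}" "r \<in> carrier R"
    and "\<And>i. f i \<in> carrier R" "\<And>i. f i \<noteq> \<zero> \<Longrightarrow> b i \<in> carrier R"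
  shows "r \<otimes> left_lincomb R b f = left_lincomb R b (\<lambda>i. r \<otimes> f i)"
proof -
  have "r \<otimes> left_lincomb R b f = (\<Oplus>i\<in>{i. f i \<noteq> \<zero>}. r \<otimes> (f i \<otimes> b i))"
    unfolding left_lincomb_def using assms by (intro finsum_rdistr) auto
  also have "\<dots> = (\<Oplus>i\<in>{i. f i \<noteq> \<zero>}. (r \<otimes> f i) \<otimes> b i)"
    using assms by (intro finsum_cong') (auto simp: m_assoc)
  also have "\<dots> = left_lincomb R b (\<lambda>i. r \<otimes> f i)"
    using assms by (intro left_lincomb_superset[symmetric]) auto
  finally show ?thesis .
qed

text \<open>Each term satisfies \<open>f i \<otimes> b i \<otimes> r = f i \<otimes> s i \<otimes> b
  i\<close>, so right multiplication by \<open>r\<close> becomes an operation on coefficients. For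
  monomials, \<open>s\<close> will be \<open>\<sigma>^\<alpha>(r)\<close>.\<close>

lemma left_lincomb_mult:
  assumes "finite {i. f i \<noteq> \<zero>}" "r \<in> carrier R"
    and "\<And>i. f i \<in> carrier R" "\<And>i. f i \<noteq> \<zero> \<Longrightarrow> b i \<in> carrier R"
    and "\<And>i. s i \<in> carrier R"
    and "\<And>i. f i \<noteq> \<zero> \<Longrightarrow> b i \<otimes> r = s i \<otimes> b i"
  shows "left_lincomb R b f \<otimes> r = left_lincomb R b (\<lambda>i. f i \<otimes> s i)"
proof -
  have "left_lincomb R b f \<otimes> r = (\<Oplus>i\<in>{i. f i \<noteq> \<zero>}. (f i \<otimes> b i) \<otimes> r)"
    unfolding left_lincomb_def using assms by (intro finsum_ldistr) auto
  also have "\<dots> = (\<Oplus>i\<in>{i. f i \<noteq> \<zero>}. (f i \<otimes> s i) \<otimes> b i)"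
    using assms by (intro finsum_cong') (auto simp: m_assoc)
  also have "\<dots> = left_lincomb R b (\<lambda>i. f i \<otimes> s i)"
    using assms by (intro left_lincomb_superset[symmetric]) auto
  finally show ?thesis .
qed

text \<open>Moving \<open>r\<close> past one factor \<open>y\<close> turns it into
  \<open>\<tau> r\<close>, hence the induction is over all \<open>r\<close>. Membership in
  \<open>K\<close> is proved alongside because the commutation rule holds only on
  \<open>K\<close>.\<close>

lemma pow_mult_twist:
  assumes "subring K R" "y \<in> carrier R" "\<tau> \<in> K \<rightarrow> K"
    and "\<And>r. r \<in> K \<Longrightarrow> y \<otimes> r = \<tau> r \<otimes> y" and "r \<in> K"
  shows "(\<tau> ^^ k) r \<in> K \<and> y [^] k \<otimes> r = (\<tau> ^^ k) r \<otimes> y [^] k"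
  using \<open>r \<in> K\<close>
proof (induction k arbitrary: r)
  case 0
  then show ?case using subringE(1)[OF assms(1)] by auto
next
  case (Suc k)
  have K: "K \<subseteq> carrier R" by (rule subringE(1)[OF assms(1)])
  have \<tau>r: "\<tau> r \<in> K" using assms(3) Suc.prems by auto
  note IH = Suc.IH[OF \<tau>r]
  have mem: "r \<in> carrier R" "\<tau> r \<in> carrier R" "(\<tau> ^^ k) (\<tau> r) \<in> carrier R"
    using Suc.prems \<tau>r IH K by auto
  have "y [^] Suc k \<otimes> r = (y [^] k \<otimes> \<tau> r) \<otimes> y"
    using assms(2) assms(4)[OF Suc.prems] mem by (simp add: m_assoc)
  also have "\<dots> = (\<tau> ^^ k) (\<tau> r) \<otimes> y [^] Suc k"
    using IH mem assms(2) by (simp add: m_assoc)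
  \<comment> \<open>The factor next to \<open>r\<close> was passed first, giving
    \<open>(\<tau> ^^ k) (\<tau> r)\<close>, whereas \<open>funpow\<close> unfolds with the new
    \<open>\<tau>\<close> outermost.\<close>
  finally show ?case using IH by (simp add: funpow_swap1)
qed

lemma monomial_closed:
  assumes "\<And>i. i \<in> {1..n} \<Longrightarrow> x i \<in> carrier R"
  shows "monomial R x n \<alpha> \<in> carrier R"
  using assms by (induction n) auto

text \<open>The element \<open>r\<close> meets the rightmost power first, so the last endomorphism
  acts first. This is the order of composition in \<open>sigma_pow\<close>, and the remaining
  shorter monomial then meets the element \<open>?s\<close>.\<close>

lemma monomial_mult_twist:
  assumes "subring K R" "\<And>i. i \<in> {1..n} \<Longrightarrow> x i \<in> carrier R"
    and "\<And>i. i \<in> {1..n} \<Longrightarrow> \<sigma> i \<in> K \<rightarrow> K"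
    and "\<And>i r. \<lbrakk>i \<in> {1..n}; r \<in> K\<rbrakk> \<Longrightarrow> x i \<otimes> r = \<sigma> i r \<otimes> x i" and "r \<in> K"
  shows "sigma_pow \<sigma> n \<alpha> r \<in> K \<and>
    monomial R x n \<alpha> \<otimes> r = sigma_pow \<sigma> n \<alpha> r \<otimes> monomial R x n \<alpha>"
  using assms(2-)
proof (induction n arbitrary: r)
  case 0
  then show ?case using subringE(1)[OF assms(1)] by auto
next
  case (Suc n)
  let ?y = "x (Suc n) [^] \<alpha> (Suc n)" and ?s = "(\<sigma> (Suc n) ^^ \<alpha> (Suc n)) r"
  have K: "K \<subseteq> carrier R" by (rule subringE(1)[OF assms(1)])
  have last: "?s \<in> K \<and> ?y \<otimes> r = ?s \<otimes> ?y"
    using Suc.prems by (intro pow_mult_twist[OF assms(1)]) auto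
  then have IH: "sigma_pow \<sigma> n \<alpha> ?s \<in> K \<and>
      monomial R x n \<alpha> \<otimes> ?s = sigma_pow \<sigma> n \<alpha> ?s \<otimes> monomial R x n \<alpha>"
    using Suc.prems by (intro Suc.IH) auto
  have mem: "r \<in> carrier R" "?s \<in> carrier R" "sigma_pow \<sigma> n \<alpha> ?s \<in> carrier R"
    "?y \<in> carrier R" "monomial R x n \<alpha> \<in> carrier R"
    using Suc.prems last IH K by (auto intro!: monomial_closed)
  have "monomial R x (Suc n) \<alpha> \<otimes> r = (monomial R x n \<alpha> \<otimes> ?s) \<otimes> ?y"
    using last mem by (simp add: m_assoc)
  also have "\<dots> = sigma_pow \<sigma> n \<alpha> ?s \<otimes> monomial R x (Suc n) \<alpha>"
    using IH mem by (simp add: m_assoc)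
  finally show ?case using IH by simp
qed

end

text \<open>Uniqueness of coefficients is available only for elements of the carrier, hence the
  closure hypothesis on the common value.\<close>

lemma left_lincomb_eq_iff:
  assumes "free_left_basis A R I b"
    and "f \<in> finsupp_coeffs A R I" "g \<in> finsupp_coeffs A R I" "left_lincomb A b f \<in> carrier A"
  shows "left_lincomb A b f = left_lincomb A b g \<longleftrightarrow> f = g"
  using assms unfolding free_left_basis_def by metis

theorem theorem1:
  fixes A :: "('a, 'm) ring_scheme" (structure)
    and R :: "'a set" and n :: nat and x :: "nat \<Rightarrow> 'a"
    and \<sigma> \<delta> :: "nat \<Rightarrow> 'a \<Rightarrow> 'a"
  assumes "cring (A\<lparr>carrier := R\<rparr>)"
    and "skew_PBW_extension A R n x"
    and "associated_maps A R n x \<sigma> \<delta>"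
    and "\<forall>i\<in>{1..n}. \<forall>r\<in>R. \<delta> i r = \<zero>"
  shows "centralizer A R =
    {left_lincomb A (monomial A x n) f | f.
       f \<in> finsupp_coeffs A R (multi_indices n) \<and>
       (\<forall>r\<in>R. \<forall>\<alpha>\<in>multi_indices n. (sigma_pow \<sigma> n \<alpha> r \<ominus> r) \<otimes> f \<alpha> = \<zero>)}"
proof -
  interpret cring "A\<lparr>carrier := R\<rparr>" by fact
  interpret P: skew_PBW_extension A R n x by fact
  let ?I = "multi_indices n" and ?b = "monomial A x n" and ?F = "finsupp_coeffs A R (multi_indices n)"
  have RA: "R \<subseteq> carrier A" and subr: "subring R A"
    using P.subset P.subring_axioms by auto
  have R0: "\<zero> \<in> R" and Rm: "\<And>a b. a \<in> R \<Longrightarrow> b \<in> R \<Longrightarrow> a \<otimes> b \<in> R"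
    using subringE(2,6)[OF subr] by auto
  have comm: "a \<otimes> b = b \<otimes> a" if "a \<in> R" "b \<in> R" for a b
    using m_comm that by simp
  have bc: "?b \<alpha> \<in> carrier A" for \<alpha>
    using P.x_closed by (rule P.monomial_closed)
  have \<sigma>: "\<sigma> i \<in> R \<rightarrow> R" if "i \<in> {1..n}" for i
    using assms(3) that unfolding associated_maps_def ring_hom_def by auto
  have "x i \<otimes> r = \<sigma> i r \<otimes> x i" if "i \<in> {1..n}" "r \<in> R" for i r
  proof -
    have "x i \<otimes> r = \<sigma> i r \<otimes> x i \<oplus> \<zero>"
      using assms(3,4) that unfolding associated_maps_def by metis
    then show ?thesis using \<sigma>[OF that(1)] that P.x_closed RA by auto
  qed
  \<comment> \<open>No condition on \<open>\<alpha>\<close> arises, since \<open>monomial\<close>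
    and \<open>sigma_pow\<close> read it only on \<open>{1..n}\<close>.\<close>
  then have tw: "sigma_pow \<sigma> n \<alpha> r \<in> R" "?b \<alpha> \<otimes> r = sigma_pow \<sigma> n \<alpha> r \<otimes> ?b \<alpha>"
    if "r \<in> R" for \<alpha> r
    using P.monomial_mult_twist[where K=R, OF subr P.x_closed \<sigma> _ that] by auto
  \<comment> \<open>The criterion for a single \<open>r\<close>; quantifying over \<open>R\<close>
    yields both inclusions at the end.\<close>
  have commute_iff: "left_lincomb A ?b f \<otimes> r = r \<otimes> left_lincomb A ?b f \<longleftrightarrow>
      (\<forall>\<alpha>\<in>?I. (sigma_pow \<sigma> n \<alpha> r \<ominus> r) \<otimes> f \<alpha> = \<zero>)"
    if f: "f \<in> ?F" and r: "r \<in> R" for f r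
  proof -
    \<comment> \<open>Outside \<open>?I\<close> the coefficient has the default value
      \<open>\<zero>\<close>, itself in \<open>R\<close>, so membership holds for every
      \<open>\<alpha>\<close>.\<close>
    have fR: "f \<alpha> \<in> R" and f0: "\<alpha> \<notin> ?I \<Longrightarrow> f \<alpha> = \<zero>" for \<alpha>
      using f R0 unfolding finsupp_coeffs_def by (cases "\<alpha> \<in> ?I"; auto)+
    have fin: "finite {\<alpha>. f \<alpha> \<noteq> \<zero>}" using f unfolding finsupp_coeffs_def by auto
    have fA: "f \<alpha> \<in> carrier A" and rA: "r \<in> carrier A"
      and sA: "sigma_pow \<sigma> n \<alpha> r \<in> carrier A" for \<alpha>
      using fR r tw(1)[OF r] RA by auto
    let ?g = "\<lambda>\<alpha>. f \<alpha> \<otimes> sigma_pow \<sigma> n \<alpha> r" and ?h = "\<lambda>\<alpha>. r \<otimes> f \<alpha>"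
    have "left_lincomb A ?b f \<otimes> r = left_lincomb A ?b ?g"
      using fin rA fA bc sA tw(2)[OF r] by (intro P.left_lincomb_mult) auto
    moreover have "r \<otimes> left_lincomb A ?b f = left_lincomb A ?b ?h"
      using fin rA fA bc by (intro P.mult_left_lincomb) auto
    \<comment> \<open>A zero coefficient of \<open>f\<close> stays zero after multiplication, so the
      support of \<open>?g\<close> lies in the finite support of \<open>f\<close>; the same applies
      to \<open>?h\<close>.\<close>
    moreover have "?g \<in> ?F"
      using fR f0 Rm tw(1)[OF r] sA
      by (auto simp: finsupp_coeffs_def intro: finite_subset[OF _ fin])
    moreover have "?h \<in> ?F"
      using fR f0 Rm r rA by (auto simp: finsupp_coeffs_def intro: finite_subset[OF _ fin])
    moreover have "left_lincomb A ?b ?g \<in> carrier A"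
      using fA sA bc by (intro P.left_lincomb_closed) auto
    ultimately have "left_lincomb A ?b f \<otimes> r = r \<otimes> left_lincomb A ?b f \<longleftrightarrow> ?g = ?h"
      using left_lincomb_eq_iff[OF P.basis] by simp
    \<comment> \<open>Off \<open>?I\<close> both families vanish together with
      \<open>f\<close>.\<close>
    also have "\<dots> \<longleftrightarrow> (\<forall>\<alpha>\<in>?I. ?g \<alpha> = ?h \<alpha>)"
      using f0 sA rA by (auto simp: fun_eq_iff)
    also have "\<dots> \<longleftrightarrow> (\<forall>\<alpha>\<in>?I. (sigma_pow \<sigma> n \<alpha> r \<ominus> r) \<otimes> f \<alpha> = \<zero>)"
    proof -
      \<comment> \<open>Commutativity of \<open>R\<close> brings \<open>f \<alpha>\<close> to the
        right, where it can be factored out of the difference of the two coefficients.\<close>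
      have "?g \<alpha> = sigma_pow \<sigma> n \<alpha> r \<otimes> f \<alpha>" for \<alpha>
        using comm fR tw(1)[OF r] by simp
      moreover have "(sigma_pow \<sigma> n \<alpha> r \<ominus> r) \<otimes> f \<alpha>
          = sigma_pow \<sigma> n \<alpha> r \<otimes> f \<alpha> \<ominus> r \<otimes> f \<alpha>" for \<alpha>
        using sA rA fA by (simp add: P.minus_eq P.l_distr P.l_minus)
      ultimately show ?thesis using sA rA fA by simp
    qed
    finally show ?thesis .
  qed
  have closed: "left_lincomb A ?b f \<in> carrier A" if "f \<in> ?F" for f
  proof (rule P.left_lincomb_closed)
    show "f \<alpha> \<in> carrier A" for \<alpha>
      using that RA unfolding finsupp_coeffs_def by (cases "\<alpha> \<in> ?I") auto
  qed (rule bc)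
  have expand: "\<exists>f\<in>?F. a = left_lincomb A ?b f" if "a \<in> carrier A" for a
    using P.basis that unfolding free_left_basis_def by blast
  show ?thesis
  proof (intro equalityI subsetI)
    fix a assume "a \<in> centralizer A R"
    then have "a \<in> carrier A" and c: "\<forall>r\<in>R. a \<otimes> r = r \<otimes> a" by (auto simp: centralizer_def)
    then obtain f where f: "f \<in> ?F" "a = left_lincomb A ?b f" using expand by blast
    then show "a \<in> {left_lincomb A ?b f | f. f \<in> ?F \<and>
        (\<forall>r\<in>R. \<forall>\<alpha>\<in>?I. (sigma_pow \<sigma> n \<alpha> r \<ominus> r) \<otimes> f \<alpha> = \<zero>)}"
      using c commute_iff[OF f(1)] by auto
  qed (auto simp: centralizer_def closed commute_iff)
qed

end
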